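(* There exists a measure $\mu$ on $[0,1)$ that is absolutely continuous with respect to Lebesgue measure, with $e^{2\pi i nx}\in L^2(\mu)$ for all $n\in\mathbb{Z}$, such that both of the following hold: (a) there is an $f\in L^2(\mu)$ such that no $\{c_n\}_{n\in\mathbb{Z}}\subseteq\mathbb{C}$ satisfies $$f=\lim_{M\to\infty}\sum_{n=-M}^{M}c_ne^{2\pi i nx}$$ with convergence in $L^2(\mu)$; (b) there is a positive semi-definite $B\in B(L^2(\mu))$ such that $\{Be^{2\pi i nx}\}_{n\in\mathbb{Z}}\subseteq L^2(\mu)$ is an orthonormal basis of $L^2(\mu)$.
   Context: $B(\mathcal{H})$ is the space of bounded linear operators on a Hilbert space $\mathcal{H}$. $L^2(\mu)$ is the complex $L^2$ space with $\langle f,h\rangle=\int f\overline{h}\,d\mu$. Measures are Borel measures. Positive semi-definite means self-adjoint with $\langle Bf,f\rangle\ge0$ for all $f$. *)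

theory Defs
  imports "HOL-Analysis.Analysis"
begin

text \<open>
  Elements of \<open>L\<^sup>2(M)\<close> are represented by square-integrable functions, and two functions
  represent the same element iff they agree almost everywhere.  Linear structure and equality
  below are therefore always read up to \<open>M\<close>-null sets.
\<close>

definition L2 :: "'a measure \<Rightarrow> ('a \<Rightarrow> complex) set" where
  "L2 M = {f \<in> borel_measurable M. integrable M (\<lambda>x. (cmod (f x))\<^sup>2)}"

definition L2_inner :: "'a measure \<Rightarrow> ('a \<Rightarrow> complex) \<Rightarrow> ('a \<Rightarrow> complex) \<Rightarrow> complex" where
  "L2_inner M f h = (\<integral>x. f x * cnj (h x) \<partial>M)"

definition L2_norm :: "'a measure \<Rightarrow> ('a \<Rightarrow> complex) \<Rightarrow> real" where
  "L2_norm M f = sqrt (\<integral>x. (cmod (f x))\<^sup>2 \<partial>M)"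

definition L2_tendsto ::
    "'a measure \<Rightarrow> (nat \<Rightarrow> 'a \<Rightarrow> complex) \<Rightarrow> ('a \<Rightarrow> complex) \<Rightarrow> bool" where
  "L2_tendsto M F f \<longleftrightarrow> (\<lambda>N. L2_norm M (\<lambda>x. F N x - f x)) \<longlonglongrightarrow> 0"

text \<open>
  An element of \<open>B(L\<^sup>2(M))\<close>, given on representatives.  The second conjunct says that the map
  descends to almost-everywhere classes.
\<close>

definition L2_bounded_operator ::
    "'a measure \<Rightarrow> (('a \<Rightarrow> complex) \<Rightarrow> 'a \<Rightarrow> complex) \<Rightarrow> bool" where
  "L2_bounded_operator M B \<longleftrightarrow>
     (\<forall>f\<in>L2 M. B f \<in> L2 M) \<and>
     (\<forall>f\<in>L2 M. \<forall>g\<in>L2 M. (AE x in M. f x = g x) \<longrightarrow> (AE x in M. B f x = B g x)) \<and>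
     (\<forall>f\<in>L2 M. \<forall>g\<in>L2 M. AE x in M. B (\<lambda>y. f y + g y) x = B f x + B g x) \<and>
     (\<forall>a. \<forall>f\<in>L2 M. AE x in M. B (\<lambda>y. a * f y) x = a * B f x) \<and>
     (\<exists>C. \<forall>f\<in>L2 M. L2_norm M (B f) \<le> C * L2_norm M f)"

definition L2_self_adjoint ::
    "'a measure \<Rightarrow> (('a \<Rightarrow> complex) \<Rightarrow> 'a \<Rightarrow> complex) \<Rightarrow> bool" where
  "L2_self_adjoint M B \<longleftrightarrow> (\<forall>f\<in>L2 M. \<forall>g\<in>L2 M. L2_inner M (B f) g = L2_inner M f (B g))"

definition L2_positive_semidefinite ::
    "'a measure \<Rightarrow> (('a \<Rightarrow> complex) \<Rightarrow> 'a \<Rightarrow> complex) \<Rightarrow> bool" where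
  "L2_positive_semidefinite M B \<longleftrightarrow>
     L2_self_adjoint M B \<and> (\<forall>f\<in>L2 M. L2_inner M (B f) f \<in> \<real>\<^sub>\<ge>\<^sub>0)"

text \<open>Orthonormal basis in the Hilbert space sense: orthonormal with dense linear span.\<close>

definition L2_orthonormal_basis :: "'a measure \<Rightarrow> ('i \<Rightarrow> 'a \<Rightarrow> complex) \<Rightarrow> bool" where
  "L2_orthonormal_basis M e \<longleftrightarrow>
     (\<forall>i. e i \<in> L2 M) \<and>
     (\<forall>i j. L2_inner M (e i) (e j) = (if i = j then 1 else 0)) \<and>
     (\<forall>f\<in>L2 M. \<forall>\<epsilon>>0. \<exists>I c. finite I \<and> L2_norm M (\<lambda>x. f x - (\<Sum>i\<in>I. c i * e i x)) < \<epsilon>)"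

definition expo :: "int \<Rightarrow> real \<Rightarrow> complex" where
  "expo n x = exp (2 * of_real pi * \<i> * of_int n * of_real x)"

end

theory Submission
  imports Defs
begin

text \<open>
  Take \<open>\<mu> = w dx\<close> with an integrable weight \<open>w \<ge> 1\<close> and let \<open>B\<close> be multiplication by \<open>w\<^sup>-\<^sup>1\<^sup>/\<^sup>2\<close>,
  which is bounded and positive.  The map \<open>f \<mapsto> w\<^sup>1\<^sup>/\<^sup>2 f\<close> is unitary from \<open>L\<^sup>2(\<mu>)\<close> onto \<open>L\<^sup>2(dx)\<close> and
  sends \<open>B e\<^sub>n\<close> to \<open>e\<^sub>n\<close>, so (b) reduces to the density of trigonometric polynomials in \<open>L\<^sup>2(dx)\<close>.

  For (a), \<open>w \<ge> 1\<close> forces the coefficients of any expansion of \<open>f\<close> to be its Fourier coefficients.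
  The function \<open>f(x) = (1/2 - x) \<Sum>\<^sub>k 2\<^sup>-\<^sup>k e(m\<^sub>k x)\<close> is bounded, while its partial Fourier sums at \<open>0\<close>,
  up to the factor \<open>\<i>/2\<pi>\<close>, are \<open>\<Sum>\<^sub>k 2\<^sup>-\<^sup>k \<Sum>\<^bsub>|j|\<le>N\<^esub> 1/(m\<^sub>k - j)\<close>, a series of nonnegative terms whose
  \<open>k\<close>-th term is at least \<open>2\<^sup>-\<^sup>k H\<^bsub>m\<^sub>k\<^esub>\<close> for \<open>N = m\<^sub>k\<close>.  With \<open>m\<^sub>k\<close> growing fast enough, the \<open>m\<^sub>k\<close>-th partial
  sum exceeds \<open>2\<^sup>k\<close> on some interval \<open>(0, d\<^sub>k)\<close>, and \<open>w = 1 + \<Sum>\<^sub>k 2\<^sup>-\<^sup>k/d\<^sub>k 1\<^bsub>(0,d\<^sub>k)\<^esub>\<close> gives it norm at least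
  \<open>2\<^sup>k\<^sup>/\<^sup>2\<close> in \<open>L\<^sup>2(\<mu>)\<close>, so the partial sums cannot converge there.
\<close>

subsection \<open>Exponentials\<close>

lemma expo_0 [simp]: "expo 0 x = 1" "expo n 0 = 1"
  by (simp_all add: expo_def)

lemma expo_add: "expo (m + n) x = expo m x * expo n x"
  by (simp add: expo_def exp_add [symmetric] algebra_simps)

lemma cnj_expo: "cnj (expo n x) = expo (- n) x"
  by (simp add: expo_def exp_cnj)

lemma norm_expo [simp]: "cmod (expo n x) = 1"
proof -
  have "expo n x = exp (\<i> * of_real (2 * pi * of_int n * x))"
    by (simp add: expo_def mult_ac)
  then show ?thesis by (simp only: norm_exp_i_times)
qed

lemma continuous_on_expo: "continuous_on A (expo n)"
  unfolding expo_def by (intro continuous_intros)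

lemma measurable_expo [measurable]: "expo n \<in> borel_measurable borel"
  by (intro borel_measurable_continuous_onI continuous_on_expo)

lemma exp_2pi_int: "exp (2 * of_real pi * \<i> * of_int n) = 1"
  using exp_integer_2pi[OF Ints_of_int[of n]] by (simp add: mult_ac)

text \<open>For \<open>n \<noteq> 0\<close> the antiderivative \<open>exp (a * x) / a\<close> takes
  equal values at both endpoints, because \<open>exp a = 1\<close>.\<close>

lemma expo_integral_0_1: "(expo n has_integral (if n = 0 then 1 else 0)) {0..1}"
proof (cases "n = 0")
  case False
  define a where "a = 2 * of_real pi * \<i> * of_int n"
  have a: "a \<noteq> 0" using False by (simp add: a_def)
  have E: "expo n = (\<lambda>x. exp (a * of_real x))"
    by (simp add: expo_def a_def fun_eq_iff)
  have "exp a = 1" unfolding a_def by (rule exp_2pi_int)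
  moreover have "((\<lambda>z. exp (a * z) / a) has_field_derivative exp (a * z)) (at z within S)" for z S
    using a by (auto intro!: derivative_eq_intros)
  then have "((\<lambda>x. exp (a * of_real x)) has_integral (exp (a * of_real 1) / a - exp (a * of_real 0) / a)) {0..1::real}"
    by (intro fundamental_theorem_of_calculus has_vector_derivative_real_field) auto
  ultimately show ?thesis using False by (simp add: E)
next
  case True
  then have "expo n = (\<lambda>x. 1)" by auto
  then show ?thesis using True has_integral_const_real[of "1::complex" 0 1] by simp
qed

text \<open>This includes \<open>n = 0\<close>, where the value is \<open>1/0 = 0\<close>.\<close>
lemma sawtooth_coefficient:
  "((\<lambda>x. of_real (1/2 - x) * expo (- n) x) has_integral (1 / (2 * of_real pi * \<i> * of_int n))) {0..1}"
proof (cases "n = 0")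
  case False
  define a where "a = 2 * of_real pi * \<i> * of_int (- n)"
  have a: "a \<noteq> 0" using False by (simp add: a_def)
  have E: "expo (- n) = (\<lambda>x. exp (a * of_real x))"
    by (simp add: expo_def a_def fun_eq_iff)
  have ea: "exp a = 1" unfolding a_def by (rule exp_2pi_int)
  \<comment> \<open>Integration by parts. Since \<open>exp a = 1\<close>, the second summand cancels
    between the endpoints and only the jump of \<open>1/2 - z\<close> from \<open>1/2\<close> to
    \<open>- 1/2\<close> survives.\<close>
  let ?F = "\<lambda>z. (1/2 - z) * (exp (a * z) / a) + exp (a * z) / a / a"
  have "(?F has_field_derivative (1/2 - z) * exp (a * z)) (at z within S)" for z S
    using a by (auto intro!: derivative_eq_intros simp: diff_divide_distrib)
  then have "((\<lambda>x. (1/2 - of_real x) * exp (a * of_real x)) has_integral (?F (of_real 1) - ?F (of_real 0))) {0..1::real}"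
    by (intro fundamental_theorem_of_calculus has_vector_derivative_real_field) auto
  also have "?F (of_real 1) - ?F (of_real 0) = - 1 / a"
    using a ea by (simp add: field_simps)
  also have "\<dots> = 1 / (2 * of_real pi * \<i> * of_int n)"
    by (simp add: a_def)
  finally show ?thesis by (simp add: E)
next
  case True
  have "((\<lambda>x. 1/2 - x) has_integral ((\<lambda>x. x / 2 - x\<^sup>2/2) 1 - (\<lambda>x. x/2 - x\<^sup>2/2) 0)) {0..1::real}"
    by (rule fundamental_theorem_of_calculus)
       (auto intro!: derivative_eq_intros simp flip: has_real_derivative_iff_has_vector_derivative)
  then have "((\<lambda>x. 1/2 - x) has_integral 0) {0..1::real}" by simp
  from has_integral_of_real[OF this, where 'b=complex] show ?thesis using True by simp
qed

section \<open>Lebesgue measure on the half-open unit interval\<close>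

abbreviation unit_lebesgue :: "real measure" where
  "unit_lebesgue \<equiv> restrict_space lborel {0..<1}"

text \<open>Passes from gauge integrals over \<open>{0..1}\<close>, which the fundamental theorem
  supplies, to Lebesgue integrals over \<open>{0..<1}\<close>; the two sets differ by the null set
  \<open>{1}\<close>.\<close>

lemma integral_unit_lebesgue:
  fixes f :: "real \<Rightarrow> complex"
  assumes f: "continuous_on {0..1} f" "(f has_integral I) {0..1}"
  shows "integral\<^sup>L unit_lebesgue f = I" "integrable unit_lebesgue f"
proof -
  have int: "set_integrable lborel {0..1} f"
    using f(1) by (rule borel_integrable_atLeastAtMost')
  then have "set_integrable lborel {0..<1} f"
    by (rule set_integrable_subset) auto
  then show "integrable unit_lebesgue f"
    by (simp add: set_integrable_def integrable_restrict_space)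
  have [measurable]: "(\<lambda>x. indicator {0..1} x *\<^sub>R f x) \<in> borel_measurable lborel"
    "(\<lambda>x. indicator {0..<1} x *\<^sub>R f x) \<in> borel_measurable lborel"
    using int \<open>set_integrable lborel {0..<1} f\<close> by (auto simp: set_integrable_def)
  have "integral\<^sup>L unit_lebesgue f = (\<integral>x. indicator {0..<1} x *\<^sub>R f x \<partial>lborel)"
    by (simp add: integral_restrict_space)
  also have "\<dots> = (\<integral>x. indicator {0..1} x *\<^sub>R f x \<partial>lborel)"
    using AE_lborel_singleton[of "1::real"]
    by (intro integral_cong_AE) (auto elim!: eventually_mono split: split_indicator)
  also have "\<dots> = integral {0..1} f"
    using set_borel_integral_eq_integral(2)[OF int] by (simp add: set_lebesgue_integral_def)
  also have "\<dots> = I" using f(2) by (rule integral_unique)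
  finally show "integral\<^sup>L unit_lebesgue f = I" .
qed

lemma expo_orthonormal:
  "(\<integral>x. expo n x * cnj (expo m x) \<partial>unit_lebesgue) = (if n = m then 1 else 0)"
proof -
  have "(\<lambda>x. expo n x * cnj (expo m x)) = expo (n - m)"
    by (simp add: cnj_expo fun_eq_iff flip: expo_add)
  then show ?thesis
    using integral_unit_lebesgue(1)[OF continuous_on_expo expo_integral_0_1, of "n - m"] by simp
qed

subsection \<open>Density of trigonometric polynomials\<close>

text \<open>The inductive form lets boundedness and closure under products go by rule induction;
  \<open>trig_polys_sum_form\<close> recovers the finite sums used for the orthonormal
  basis.\<close>

inductive_set trig_polys :: "(real \<Rightarrow> complex) set" where
  monomial: "(\<lambda>x. c * expo n x) \<in> trig_polys"
| add: "p \<in> trig_polys \<Longrightarrow> q \<in> trig_polys \<Longrightarrow> (\<lambda>x. p x + q x) \<in> trig_polys"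

lemma trig_polys_const: "(\<lambda>x. c) \<in> trig_polys"
  using trig_polys.monomial[of c 0] by simp

lemma trig_polys_mult:
  assumes "p \<in> trig_polys" "q \<in> trig_polys"
  shows "(\<lambda>x. p x * q x) \<in> trig_polys"
  using assms
proof (induction p)
  case (monomial c n)
  from monomial show ?case
  proof (induction q)
    case (monomial d m)
    have "(\<lambda>x. (c * expo n x) * (d * expo m x)) = (\<lambda>x. (c * d) * expo (n + m) x)"
      unfolding expo_add by (simp add: mult_ac)
    then show ?case by (simp only: trig_polys.monomial)
  next
    case (add p q)
    show ?case unfolding distrib_left by (rule trig_polys.add[OF add.IH])
  qed
next
  case (add p q)
  show ?case
    unfolding distrib_right by (rule trig_polys.add[OF add.IH(1)[OF add.prems] add.IH(2)[OF add.prems]])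
qed

lemma trig_polys_sum_form:
  assumes "p \<in> trig_polys"
  shows "\<exists>I c. finite I \<and> p = (\<lambda>x. \<Sum>i\<in>I. c i * expo i x)"
  using assms
proof induction
  case (monomial c n)
  show ?case by (rule exI[of _ "{n}"], rule exI[of _ "\<lambda>_. c"]) simp
next
  case (add p q)
  then obtain I c J d where *: "finite I" "p = (\<lambda>x. \<Sum>i\<in>I. c i * expo i x)"
    "finite J" "q = (\<lambda>x. \<Sum>i\<in>J. d i * expo i x)" by blast
  \<comment> \<open>Extending both coefficient families by zero puts the two sums over the common
    index set \<open>I \<union> J\<close>.\<close>
  define c' d' where "c' i = (if i \<in> I then c i else 0)" and "d' i = (if i \<in> J then d i else 0)" for i
  have "(\<Sum>i\<in>I. c i * expo i x) = (\<Sum>i\<in>I \<union> J. c' i * expo i x)" for x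
    using * by (intro sum.mono_neutral_cong_left) (auto simp: c'_def)
  moreover have "(\<Sum>i\<in>J. d i * expo i x) = (\<Sum>i\<in>I \<union> J. d' i * expo i x)" for x
    using * by (intro sum.mono_neutral_cong_left) (auto simp: d'_def)
  ultimately have "(\<lambda>x. p x + q x) = (\<lambda>x. \<Sum>i\<in>I \<union> J. (c' i + d' i) * expo i x)"
    by (simp add: *(2,4) sum.distrib distrib_right)
  moreover have "finite (I \<union> J)" using * by simp
  ultimately show ?case
    by (intro exI[of _ "I \<union> J"] exI[of _ "\<lambda>i. c' i + d' i"] conjI)
qed

lemma measurable_trig_polys: "p \<in> trig_polys \<Longrightarrow> p \<in> borel_measurable borel"
  by (induction rule: trig_polys.induct) auto

lemma bounded_trig_polys: "p \<in> trig_polys \<Longrightarrow> \<exists>C. \<forall>x. cmod (p x) \<le> C"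
proof (induction rule: trig_polys.induct)
  case (monomial c n)
  show ?case by (intro exI[of _ "cmod c"]) (simp add: norm_mult)
next
  case (add p q)
  then obtain C D where "\<forall>x. cmod (p x) \<le> C" "\<forall>x. cmod (q x) \<le> D" by blast
  then have "cmod (p x + q x) \<le> C + D" for x
    by (intro norm_triangle_le add_mono) auto
  then show ?case by blast
qed

text \<open>A real-linear functional on the plane is a complex combination of \<open>z\<close> and
  \<open>cnj z\<close>, which for \<open>z = expo 1 x\<close> are the exponentials
  \<open>expo 1 x\<close> and \<open>expo (- 1) x\<close>.\<close>

lemma real_polynomial_expo:
  fixes g :: "complex \<Rightarrow> real"
  assumes "real_polynomial_function g"
  shows "(\<lambda>x. of_real (g (expo 1 x))) \<in> trig_polys"
  using assms
proof induction
  case (linear f)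
  \<comment> \<open>The coefficients come from \<open>Re z = (z + cnj z) / 2\<close> and
    \<open>Im z = (z - cnj z) / (2 * \<i>)\<close>.\<close>
  have "of_real (f (expo 1 x)) = ((of_real (f 1) - \<i> * of_real (f \<i>)) / 2) * expo 1 x
      + ((of_real (f 1) + \<i> * of_real (f \<i>)) / 2) * expo (- 1) x" for x
  proof -
    interpret bounded_linear f by fact
    let ?z = "expo 1 x"
    have "f ?z = f (Re ?z *\<^sub>R 1 + Im ?z *\<^sub>R \<i>)"
      by (metis complex_eq mult.commute mult.right_neutral scaleR_conv_of_real)
    also have "\<dots> = Re ?z * f 1 + Im ?z * f \<i>"
      by (simp only: add scaleR real_scaleR_def)
    finally have f: "f ?z = Re ?z * f 1 + Im ?z * f \<i>" .
    show ?thesis unfolding f cnj_expo[of 1, symmetric] complex_eq_iff by (simp add: field_simps)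
  qed
  then show ?case
    using trig_polys.add[OF trig_polys.monomial trig_polys.monomial] by presburger
next
  case (const c)
  show ?case by (rule trig_polys_const)
next
  case (add f g)
  show ?case unfolding of_real_add by (rule trig_polys.add[OF add.IH])
next
  case (mult f g)
  show ?case unfolding of_real_mult by (rule trig_polys_mult[OF mult.IH])
qed

section \<open>Square-integrable functions\<close>

lemma L2_measurable: "f \<in> L2 M \<Longrightarrow> f \<in> borel_measurable M"
  and L2_integrable: "f \<in> L2 M \<Longrightarrow> integrable M (\<lambda>x. (cmod (f x))\<^sup>2)"
  by (simp_all add: L2_def)

lemma norm_add_sq_le: "(norm (a + b))\<^sup>2 \<le> 2 * (norm a)\<^sup>2 + 2 * (norm b)\<^sup>2"
proof -
  have "(norm (a + b))\<^sup>2 \<le> (norm a + norm b)\<^sup>2"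
    by (intro power_mono norm_triangle_ineq) simp
  also have "\<dots> \<le> 2 * (norm a)\<^sup>2 + 2 * (norm b)\<^sup>2"
    using zero_le_power2[of "norm a - norm b"] by (simp add: power2_eq_square algebra_simps)
  finally show ?thesis .
qed

lemma L2_dominated:
  assumes "f \<in> borel_measurable M" "integrable M h" "\<And>x. x \<in> space M \<Longrightarrow> (cmod (f x))\<^sup>2 \<le> h x"
  shows "f \<in> L2 M"
  unfolding L2_def
proof (intro CollectI conjI)
  show "integrable M (\<lambda>x. (cmod (f x))\<^sup>2)"
    using assms by (intro Bochner_Integration.integrable_bound[OF assms(2)])
      (auto intro!: AE_I2 intro: order_trans abs_ge_self)
qed fact

lemma L2_add: assumes "f \<in> L2 M" "g \<in> L2 M" shows "(\<lambda>x. f x + g x) \<in> L2 M"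
proof (rule L2_dominated)
  show "integrable M (\<lambda>x. 2 * (cmod (f x))\<^sup>2 + 2 * (cmod (g x))\<^sup>2)"
    using assms by (intro Bochner_Integration.integrable_add integrable_mult_right L2_integrable)
qed (use assms in \<open>auto simp: L2_def norm_add_sq_le\<close>)

lemma L2_cmult: "f \<in> L2 M \<Longrightarrow> (\<lambda>x. c * f x) \<in> L2 M"
  by (auto simp: L2_def norm_mult power_mult_distrib)

lemma L2_diff: assumes "f \<in> L2 M" "g \<in> L2 M" shows "(\<lambda>x. f x - g x) \<in> L2 M"
  using L2_add[OF assms(1) L2_cmult[OF assms(2), of "-1"]] by simp

lemma (in finite_measure) L2_bounded:
  assumes "f \<in> borel_measurable M" "\<And>x. x \<in> space M \<Longrightarrow> cmod (f x) \<le> C"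
  shows "f \<in> L2 M"
  using assms by (intro L2_dominated[of f M "\<lambda>_. C\<^sup>2"]) (auto intro: power_mono)

section \<open>Mean-square approximation by trigonometric polynomials\<close>

definition trig_approximable :: "real measure \<Rightarrow> (real \<Rightarrow> complex) \<Rightarrow> bool" where
  "trig_approximable M g \<longleftrightarrow> g \<in> L2 M \<and>
     (\<forall>\<epsilon>>0. \<exists>p\<in>trig_polys. (\<integral>x. (cmod (g x - p x))\<^sup>2 \<partial>M) < \<epsilon>)"

text \<open>Kept general because the setting is used both for \<open>unit_lebesgue\<close> and for
  the weighted measure.\<close>

locale circle_measure = finite_measure M for M :: "real measure" +
  assumes sets_M: "sets M = sets (restrict_space borel {0..<1})"
begin

lemma space_M: "space M = {0..<1}"
  using sets_eq_imp_space_eq[OF sets_M] by (simp add: space_restrict_space)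

lemma measurable_M: "f \<in> borel_measurable borel \<Longrightarrow> f \<in> borel_measurable M"
  using measurable_restrict_space1[of f borel] measurable_cong_sets[OF sets_M refl] by blast

lemma trig_polys_L2: "p \<in> trig_polys \<Longrightarrow> p \<in> L2 M"
  using bounded_trig_polys[of p] by (auto intro: L2_bounded measurable_M measurable_trig_polys)

text \<open>Errors are squared norms, so \<open>norm_add_sq_le\<close> stands in for the triangle
  inequality; its factor 2 is why both errors are taken below \<open>\<epsilon> / 4\<close>.\<close>

lemma trig_approximable_close:
  assumes "g \<in> L2 M"
    and "\<And>\<epsilon>. \<epsilon> > 0 \<Longrightarrow> \<exists>h. trig_approximable M h \<and> (\<integral>x. (cmod (g x - h x))\<^sup>2 \<partial>M) < \<epsilon>"
  shows "trig_approximable M g"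
  unfolding trig_approximable_def
proof (intro conjI allI impI)
  fix \<epsilon> :: real assume "\<epsilon> > 0"
  then obtain h where h: "trig_approximable M h" "(\<integral>x. (cmod (g x - h x))\<^sup>2 \<partial>M) < \<epsilon> / 4"
    using assms(2)[of "\<epsilon> / 4"] by auto
  then have hL: "h \<in> L2 M" by (simp add: trig_approximable_def)
  obtain p where p: "p \<in> trig_polys" "(\<integral>x. (cmod (h x - p x))\<^sup>2 \<partial>M) < \<epsilon> / 4"
    using h \<open>\<epsilon> > 0\<close> unfolding trig_approximable_def by (meson divide_pos_pos zero_less_numeral)
  note pL = trig_polys_L2[OF p(1)]
  have "(\<integral>x. (cmod (g x - p x))\<^sup>2 \<partial>M) \<le> (\<integral>x. 2 * (cmod (g x - h x))\<^sup>2 + 2 * (cmod (h x - p x))\<^sup>2 \<partial>M)"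
    using norm_add_sq_le[of "g x - h x" "h x - p x" for x]
    by (intro integral_mono Bochner_Integration.integrable_add integrable_mult_right L2_integrable L2_diff assms hL pL) auto
  also have "\<dots> = 2 * (\<integral>x. (cmod (g x - h x))\<^sup>2 \<partial>M) + 2 * (\<integral>x. (cmod (h x - p x))\<^sup>2 \<partial>M)"
    using L2_integrable[OF L2_diff[OF assms(1) hL]] L2_integrable[OF L2_diff[OF hL pL]] by simp
  also have "\<dots> < \<epsilon>" using h p by simp
  finally show "\<exists>p\<in>trig_polys. (\<integral>x. (cmod (g x - p x))\<^sup>2 \<partial>M) < \<epsilon>" using p by blast
qed fact

lemma trig_approximable_add:
  assumes "trig_approximable M g" "trig_approximable M h"
  shows "trig_approximable M (\<lambda>x. g x + h x)"
  unfolding trig_approximable_def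
proof (intro conjI allI impI)
  have L: "g \<in> L2 M" "h \<in> L2 M" using assms by (auto simp: trig_approximable_def)
  then show "(\<lambda>x. g x + h x) \<in> L2 M" by (rule L2_add)
  fix \<epsilon> :: real assume "\<epsilon> > 0"
  then have "\<epsilon> / 4 > 0" by simp
  then obtain p q where p: "p \<in> trig_polys" "(\<integral>x. (cmod (g x - p x))\<^sup>2 \<partial>M) < \<epsilon> / 4"
    and q: "q \<in> trig_polys" "(\<integral>x. (cmod (h x - q x))\<^sup>2 \<partial>M) < \<epsilon> / 4"
    using assms unfolding trig_approximable_def by meson
  have I: "integrable M (\<lambda>x. (cmod (g x - p x))\<^sup>2)" "integrable M (\<lambda>x. (cmod (h x - q x))\<^sup>2)"
    by (intro L2_integrable L2_diff L trig_polys_L2 p q)+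
  have "(\<integral>x. (cmod (g x + h x - (p x + q x)))\<^sup>2 \<partial>M)
      \<le> (\<integral>x. 2 * (cmod (g x - p x))\<^sup>2 + 2 * (cmod (h x - q x))\<^sup>2 \<partial>M)"
    using norm_add_sq_le[of "g x - p x" "h x - q x" for x, folded add_diff_add]
    by (intro integral_mono Bochner_Integration.integrable_add integrable_mult_right I L2_integrable
         L2_diff L2_add L trig_polys_L2 p q trig_polys.add) auto
  also have "\<dots> < \<epsilon>" using p q I by simp
  finally show "\<exists>p\<in>trig_polys. (\<integral>x. (cmod (g x + h x - p x))\<^sup>2 \<partial>M) < \<epsilon>"
    by (rule bexI[where x = "\<lambda>x. p x + q x"]) (rule trig_polys.add[OF p(1) q(1)])
qed

lemma trig_approximable_trig_poly: "p \<in> trig_polys \<Longrightarrow> trig_approximable M p"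
  unfolding trig_approximable_def by (intro conjI allI impI trig_polys_L2 bexI[of _ p]) auto

lemma trig_approximable_cmult:
  assumes "trig_approximable M g"
  shows "trig_approximable M (\<lambda>x. c * g x)"
  unfolding trig_approximable_def
proof (intro conjI allI impI)
  show "(\<lambda>x. c * g x) \<in> L2 M" using assms by (auto simp: trig_approximable_def L2_cmult)
  fix \<epsilon> :: real assume "\<epsilon> > 0"
  \<comment> \<open>The summand \<open>1\<close> keeps the denominator positive when
    \<open>c = 0\<close>.\<close>
  then have "\<epsilon> / ((cmod c)\<^sup>2 + 1) > 0" by (simp add: add_nonneg_pos)
  then obtain p where p: "p \<in> trig_polys" "(\<integral>x. (cmod (g x - p x))\<^sup>2 \<partial>M) < \<epsilon> / ((cmod c)\<^sup>2 + 1)"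
    using assms unfolding trig_approximable_def by meson
  have "(\<integral>x. (cmod (c * g x - c * p x))\<^sup>2 \<partial>M) = (cmod c)\<^sup>2 * (\<integral>x. (cmod (g x - p x))\<^sup>2 \<partial>M)"
    unfolding right_diff_distrib[symmetric] norm_mult power_mult_distrib by simp
  also have "\<dots> \<le> ((cmod c)\<^sup>2 + 1) * (\<integral>x. (cmod (g x - p x))\<^sup>2 \<partial>M)"
    by (intro mult_right_mono) auto
  also have "\<dots> < \<epsilon>"
    using p by (simp add: pos_less_divide_eq add_nonneg_pos mult.commute)
  finally show "\<exists>p\<in>trig_polys. (\<integral>x. (cmod (c * g x - p x))\<^sup>2 \<partial>M) < \<epsilon>"
    by (rule bexI[where x = "\<lambda>x. c * p x"]) (rule trig_polys_mult[OF trig_polys_const p(1)])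
qed

lemma trig_approximable_sum:
  assumes "\<And>i. i \<in> I \<Longrightarrow> trig_approximable M (g i)"
  shows "trig_approximable M (\<lambda>x. \<Sum>i\<in>I. g i x)"
  using assms
proof (induction I rule: infinite_finite_induct)
  case (insert i I)
  then show ?case by (simp add: trig_approximable_add)
qed (simp_all add: trig_approximable_trig_poly trig_polys_const)

text \<open>Dominated convergence turns the pointwise limit into a mean-square limit, and
  approximability is closed under the latter. The passage to continuous functions, indicators and
  simple functions rests on this.\<close>

lemma trig_approximable_limit:
  assumes s: "\<And>i. trig_approximable M (s i)" and g: "g \<in> borel_measurable M"
    and lim: "\<And>x. x \<in> space M \<Longrightarrow> (\<lambda>i. s i x) \<longlonglongrightarrow> g x"
    and h: "integrable M h" "\<And>i x. x \<in> space M \<Longrightarrow> (cmod (s i x))\<^sup>2 \<le> h x"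
  shows "trig_approximable M g"
proof (rule trig_approximable_close)
  have gh: "(cmod (g x))\<^sup>2 \<le> h x" if "x \<in> space M" for x
    using that by (intro LIMSEQ_le_const2[OF tendsto_power[OF tendsto_norm[OF lim]]]) (auto intro: h)
  show "g \<in> L2 M" by (rule L2_dominated[OF g h(1) gh])
  have [measurable]: "s i \<in> borel_measurable M" "g \<in> borel_measurable M" for i
    using s g by (auto simp: trig_approximable_def L2_def)
  have "(\<lambda>i. \<integral>x. (cmod (g x - s i x))\<^sup>2 \<partial>M) \<longlonglongrightarrow> (\<integral>x. 0 \<partial>M)"
  proof (rule integral_dominated_convergence)
    \<comment> \<open>The squares of \<open>g\<close> and of \<open>s i\<close> are both at most
      \<open>h\<close>, so \<open>norm_add_sq_le\<close> yields the majorant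
      \<open>2 * h + 2 * h\<close>.\<close>
    show "integrable M (\<lambda>x. 4 * h x)" using h by simp
    show "AE x in M. (\<lambda>i. (cmod (g x - s i x))\<^sup>2) \<longlonglongrightarrow> 0"
    proof (intro AE_I2)
      fix x assume "x \<in> space M"
      then have "(\<lambda>i. (cmod (g x - s i x))\<^sup>2) \<longlonglongrightarrow> (cmod (g x - g x))\<^sup>2"
        by (intro tendsto_intros lim)
      then show "(\<lambda>i. (cmod (g x - s i x))\<^sup>2) \<longlonglongrightarrow> 0" by simp
    qed
    show "AE x in M. norm ((cmod (g x - s i x))\<^sup>2) \<le> 4 * h x" for i
    proof (intro AE_I2)
      fix x assume "x \<in> space M"
      then show "norm ((cmod (g x - s i x))\<^sup>2) \<le> 4 * h x"
        using norm_add_sq_le[of "g x" "- s i x"] gh[of x] h(2)[of x i] by simp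
    qed
  qed auto
  then have lim0: "(\<lambda>i. \<integral>x. (cmod (g x - s i x))\<^sup>2 \<partial>M) \<longlonglongrightarrow> 0" by simp
  fix \<epsilon> :: real assume "\<epsilon> > 0"
  from order_tendstoD(2)[OF lim0 this] show "\<exists>h. trig_approximable M h \<and> (\<integral>x. (cmod (g x - h x))\<^sup>2 \<partial>M) < \<epsilon>"
    using s by (auto simp: eventually_sequentially)
qed

text \<open>Stone-Weierstrass on the unit circle, where polynomials become trigonometric
  polynomials. Functions of \<open>expo 1 x\<close> rather than of \<open>x\<close> have the
  periodicity that uniform approximation requires.\<close>

lemma trig_approximable_continuous:
  fixes \<phi> :: "complex \<Rightarrow> real"
  assumes "continuous_on UNIV \<phi>"
  shows "trig_approximable M (\<lambda>x. of_real (\<phi> (expo 1 x)))"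
proof -
  have "\<exists>g. real_polynomial_function g \<and> (\<forall>z\<in>sphere 0 1. \<bar>\<phi> z - g z\<bar> < 1 / Suc n)" for n
  proof -
    have "continuous_on (sphere 0 1) \<phi>" by (rule continuous_on_subset[OF assms]) simp
    from Stone_Weierstrass_real_polynomial_function[OF compact_sphere this, of "1 / Suc n"]
    show ?thesis by (metis of_nat_0_less_iff zero_less_Suc zero_less_divide_1_iff)
  qed
  then obtain g where g: "\<And>n. real_polynomial_function (g n)"
    "\<And>n z. z \<in> sphere 0 1 \<Longrightarrow> \<bar>\<phi> z - g n z\<bar> < 1 / Suc n" by metis
  have "compact (\<phi> ` sphere 0 1)"
    using continuous_on_subset[OF assms] by (intro compact_continuous_image) auto
  then obtain C where C: "\<And>z. z \<in> sphere 0 1 \<Longrightarrow> \<bar>\<phi> z\<bar> \<le> C"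
    by (force dest!: compact_imp_bounded simp: bounded_iff)
  show ?thesis
  proof (rule trig_approximable_limit)
    show "trig_approximable M (\<lambda>x. of_real (g n (expo 1 x)))" for n
      by (intro trig_approximable_trig_poly real_polynomial_expo g)
    show "(\<lambda>x. complex_of_real (\<phi> (expo 1 x))) \<in> borel_measurable M"
    proof (intro measurable_M)
      have [measurable]: "\<phi> \<in> borel_measurable borel"
        using assms by (rule borel_measurable_continuous_onI)
      show "(\<lambda>x. complex_of_real (\<phi> (expo 1 x))) \<in> borel_measurable borel" by measurable
    qed
    have close: "\<bar>\<phi> (expo 1 x) - g n (expo 1 x)\<bar> < 1 / Suc n" for n x
      by (rule g) simp
    show "(\<lambda>n. complex_of_real (g n (expo 1 x))) \<longlonglongrightarrow> of_real (\<phi> (expo 1 x))" for x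
    proof (intro tendsto_of_real)
      show "(\<lambda>n. g n (expo 1 x)) \<longlonglongrightarrow> \<phi> (expo 1 x)"
        by (rule LIM_zero_cancel, rule Lim_null_comparison[OF _ LIMSEQ_inverse_real_of_nat])
           (use close in \<open>auto simp: abs_minus_commute inverse_eq_divide intro!: always_eventually less_imp_le\<close>)
    qed
    \<comment> \<open>\<open>C\<close> bounds \<open>\<phi>\<close> on the circle, and the error
      \<open>1 / Suc n\<close> of the approximants is at most \<open>1\<close>.\<close>
    show "integrable M (\<lambda>_. (C + 1)\<^sup>2)" by simp
    show "(cmod (of_real (g n (expo 1 x))))\<^sup>2 \<le> (C + 1)\<^sup>2" for n x
    proof (intro power_mono)
      have "1 / real (Suc n) \<le> 1" "\<bar>\<phi> (expo 1 x)\<bar> \<le> C" by (simp_all add: C)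
      then show "cmod (of_real (g n (expo 1 x))) \<le> C + 1"
        using close[of x n] unfolding norm_of_real by linarith
    qed simp
  qed
qed

text \<open>The continuous functions \<open>min 1 (n * infdist z (- U))\<close> tend pointwise to
  the indicator of \<open>U\<close>.\<close>

lemma trig_approximable_open:
  assumes "open U"
  shows "trig_approximable M (\<lambda>x. indicator U (expo 1 x))"
\<comment> \<open>\<open>infdist\<close> to the empty set is \<open>0\<close>, so for
  \<open>U = UNIV\<close> the approximants used below would vanish.\<close>
proof (cases "U = UNIV")
  case True
  then show ?thesis by (simp add: trig_approximable_trig_poly trig_polys_const)
next
  case False
  show ?thesis
  proof (rule trig_approximable_limit)
    let ?\<phi> = "\<lambda>n z. min 1 (real n * infdist z (- U))"
    show "trig_approximable M (\<lambda>x. of_real (?\<phi> n (expo 1 x)))" for n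
      by (intro trig_approximable_continuous continuous_intros)
    show "(\<lambda>x. indicator U (expo 1 x)) \<in> borel_measurable M"
    proof (intro measurable_M)
      have [measurable]: "U \<in> sets borel" using assms by simp
      show "(\<lambda>x. indicator U (expo 1 x)) \<in> borel_measurable borel" by measurable
    qed
    show "integrable M (\<lambda>_. 1 :: real)" by simp
    show "(cmod (of_real (?\<phi> n (expo 1 x))))\<^sup>2 \<le> 1" for n x
      using infdist_nonneg[of "expo 1 x" "- U"] by (auto simp: power_le_one_iff)
    show "(\<lambda>n. complex_of_real (?\<phi> n (expo 1 x))) \<longlonglongrightarrow> indicator U (expo 1 x)" for x
    proof (cases "expo 1 x \<in> U")
      case True
      with assms False have pos: "infdist (expo 1 x) (- U) > 0"
        by (intro infdist_pos_not_in_closed) auto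
      obtain N where N: "real N * infdist (expo 1 x) (- U) > 1"
        using reals_Archimedean3[OF pos] by blast
      have "eventually (\<lambda>n. complex_of_real (?\<phi> n (expo 1 x)) = 1) sequentially"
        unfolding eventually_sequentially
      proof (intro exI allI impI)
        fix n assume "n \<ge> N"
        then have "real N * infdist (expo 1 x) (- U) \<le> real n * infdist (expo 1 x) (- U)"
          using pos by simp
        then show "complex_of_real (?\<phi> n (expo 1 x)) = 1" using N by simp
      qed
      then have "(\<lambda>n. complex_of_real (?\<phi> n (expo 1 x))) \<longlonglongrightarrow> 1"
        by (rule tendsto_eventually)
      then show ?thesis using True by simp
    qed simp
  qed
qed

text \<open>Dynkin's pi-lambda argument from the intersection-stable family of open sets; a
  countable disjoint union is a pointwise limit of finite ones, bounded by \<open>1\<close>.\<close>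

lemma trig_approximable_borel:
  assumes "A \<in> sets (borel :: complex measure)"
  shows "trig_approximable M (\<lambda>x. indicator A (expo 1 x))"
proof -
  have "Int_stable (Collect open :: complex set set)" by (auto simp: Int_stable_def)
  moreover have "(Collect open :: complex set set) \<subseteq> Pow UNIV" by simp
  moreover have "A \<in> sigma_sets UNIV (Collect open)"
    using assms by (simp add: borel_def)
  ultimately show ?thesis
  proof (induction rule: sigma_sets_induct_disjoint)
    case (basic A)
    then show ?case by (simp add: trig_approximable_open)
  next
    case empty
    then show ?case by (simp add: trig_approximable_trig_poly trig_polys_const)
  next
    case (compl A)
    have "trig_approximable M (\<lambda>x. 1 + (- 1) * indicator A (expo 1 x))"
      by (intro trig_approximable_add trig_approximable_cmult trig_approximable_trig_poly trig_polys_const compl)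
    then show ?case by (simp add: indicator_diff)
  next
    case (union A)
    have A: "A i \<in> sets borel" for i using union(2) by (auto simp: borel_def)
    show ?case
    proof (rule trig_approximable_limit)
      show "trig_approximable M (\<lambda>x. \<Sum>i<n. indicator (A i) (expo 1 x))" for n
        by (intro trig_approximable_sum union)
      have [measurable]: "(\<Union>i. A i) \<in> sets borel" using A by auto
      show "(\<lambda>x. indicator (\<Union>i. A i) (expo 1 x)) \<in> borel_measurable M"
        by (intro measurable_M) measurable
      have eq: "(\<Sum>i<n. indicator (A i) z) = (indicator (\<Union>i<n. A i) z :: complex)" for n z
        using union(1) by (intro indicator_UN_disjoint[symmetric] disjoint_family_on_mono[OF _ union(1)]) auto
      show "integrable M (\<lambda>_. 1 :: real)" by simp
      show "(cmod (\<Sum>i<n. indicator (A i) (expo 1 x)))\<^sup>2 \<le> 1" for n x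
        unfolding eq by (simp add: indicator_def)
      show "(\<lambda>n. \<Sum>i<n. indicator (A i) (expo 1 x)) \<longlonglongrightarrow> (indicator (\<Union>i. A i) (expo 1 x) :: complex)" for x
        unfolding eq by (rule LIMSEQ_indicator_UN)
    qed
  qed
qed

text \<open>A Borel subset of \<open>[0,1)\<close> is the preimage of a Borel subset of the plane, as \<open>Arg2pi\<close> is measurable.\<close>
lemma trig_approximable_indicator:
  assumes "S \<in> sets M"
  shows "trig_approximable M (indicator S)"
proof -
  obtain T where T: "T \<in> sets borel" "S = T \<inter> {0..<1}"
    using assms by (auto simp: sets_M sets_restrict_space)
  have [measurable]: "Arg2pi \<in> borel_measurable borel"
    by (rule borel_measurableI_le) (simp add: closed_Arg2pi2pi_le)
  define A where "A = {z. Arg2pi z / (2 * pi) \<in> T}"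
  have "A \<in> sets borel" unfolding A_def using T(1) by measurable
  then have A: "trig_approximable M (\<lambda>x. indicator A (expo 1 x))"
    by (rule trig_approximable_borel)
  have eq: "indicator A (expo 1 x) = (indicator S x :: complex)" if "x \<in> space M" for x
  proof -
    \<comment> \<open>\<open>Arg2pi\<close> takes values in \<open>[0, 2 * pi)\<close>, which
      contains \<open>2 * pi * x\<close> since \<open>x < 1\<close>.\<close>
    have "Arg2pi (expo 1 x) = 2 * pi * x"
      using that by (intro Arg2pi_unique[of 1]) (auto simp: expo_def space_M mult_ac)
    then show ?thesis using that by (auto simp: A_def T space_M indicator_def)
  qed
  show ?thesis
  proof (rule trig_approximable_limit[of "\<lambda>_ x. indicator A (expo 1 x)" _ "\<lambda>_. 1", OF A])
    show "(\<lambda>_. indicator A (expo 1 x) :: complex) \<longlonglongrightarrow> indicator S x" if "x \<in> space M" for x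
      unfolding eq[OF that] by (rule tendsto_const)
    show "indicator S \<in> borel_measurable M" using assms by (rule borel_measurable_indicator)
    show "(cmod (indicator A (expo 1 x)))\<^sup>2 \<le> 1" for x by (simp add: indicator_def)
  qed simp_all
qed

text \<open>Simple functions tend to \<open>g\<close> pointwise with modulus at most
  \<open>2 * cmod (g x)\<close>, hence with the integrable majorant
  \<open>4 * (cmod (g x))\<^sup>2\<close> for the squares.\<close>

lemma trig_polys_dense_L2:
  assumes "g \<in> L2 M"
  shows "trig_approximable M g"
proof -
  have [measurable]: "g \<in> borel_measurable M" using assms by (rule L2_measurable)
  then obtain s where s: "\<And>i. simple_function M (s i)"
    "\<And>x. x \<in> space M \<Longrightarrow> (\<lambda>i. s i x) \<longlonglongrightarrow> g x"
    "\<And>i x. x \<in> space M \<Longrightarrow> cmod (s i x) \<le> 2 * cmod (g x)"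
    using borel_measurable_implies_sequence_metric[of g M 0] by simp metis
  \<comment> \<open>The simple function \<open>s i\<close>, written as a combination of indicators
    of its level sets.\<close>
  let ?t = "\<lambda>i x. \<Sum>y\<in>s i ` space M. y * indicator (s i -` {y} \<inter> space M) x"
  have *: "trig_approximable M (?t i)" for i
    by (intro trig_approximable_sum trig_approximable_cmult trig_approximable_indicator
        simple_functionD s)
  have eq: "?t i x = s i x" if "x \<in> space M" for i x
  proof -
    have "?t i x = (\<Sum>y\<in>s i ` space M. if s i x = y then y else 0)"
      using that by (intro sum.cong) (auto simp: indicator_def)
    also have "\<dots> = s i x" using that simple_functionD(1)[OF s(1)] by simp
    finally show ?thesis .
  qed
  show ?thesis
  proof (rule trig_approximable_limit[of ?t, OF *])
    show "integrable M (\<lambda>x. 4 * (cmod (g x))\<^sup>2)" using L2_integrable[OF assms] by simp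
    show "(cmod (?t i x))\<^sup>2 \<le> 4 * (cmod (g x))\<^sup>2"
      if "x \<in> space M" for i x
      using power_mono[OF s(3)[OF that, of i], of 2] by (simp add: eq[OF that] power_mult_distrib)
    show "(\<lambda>i. ?t i x) \<longlonglongrightarrow> g x" if "x \<in> space M" for x
      unfolding eq[OF that] by (rule s(2)[OF that])
  qed measurable
qed

end

subsection \<open>A bounded function with unbounded partial Fourier sums\<close>

lemma sum_symmetric_Suc:
  fixes F :: "int \<Rightarrow> 'a::comm_monoid_add"
  shows "(\<Sum>j = - int (Suc N)..int (Suc N). F j) = (\<Sum>j = - int N..int N. F j) + F (- int (Suc N)) + F (int (Suc N))"
proof -
  have "{- int (Suc N)..int (Suc N)} = insert (- int (Suc N)) (insert (int (Suc N)) {- int N..int N})"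
    by auto
  then show ?thesis by (simp add: add_ac)
qed

lemma sum_symmetric_telescope:
  fixes G :: "int \<Rightarrow> real"
  shows "(\<Sum>j = - int N..int N. G (j - 1) - G j) = G (- int N - 1) - G (int N)"
proof (induction N)
  case (Suc N)
  have "G (- 1 - int N) = G (- int N - 1)" by (rule arg_cong[of _ _ G]) simp
  with Suc show ?case unfolding sum_symmetric_Suc by (simp add: algebra_simps)
qed simp

text \<open>The term \<open>j = m\<close> contributes \<open>1/0 = 0\<close>.\<close>
definition symmetric_kernel :: "nat \<Rightarrow> nat \<Rightarrow> real" where
  "symmetric_kernel N m = (\<Sum>j = - int N..int N. 1 / (real m - of_int j))"

lemma symmetric_kernel_0: "symmetric_kernel N 0 = 0"
  unfolding symmetric_kernel_def
proof (induction N)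
  case (Suc N)
  have "1 / (- 1 - real N) = - (1 / (real N + 1))"
    unfolding minus_divide_right by simp
  with Suc show ?case unfolding sum_symmetric_Suc by simp
qed simp

text \<open>Raising \<open>m\<close> by one shifts the summation index, so the difference
  telescopes. At \<open>m = N\<close> the last term is \<open>1 / 0 = 0\<close>, in line with the
  convention for the kernel.\<close>

lemma symmetric_kernel_Suc:
  "symmetric_kernel N (Suc m) = symmetric_kernel N m + 1 / (real m + N + 1) - 1 / (real m - N)"
proof -
  have "symmetric_kernel N (Suc m) - symmetric_kernel N m
      = (\<Sum>j = - int N..int N. 1 / (real m - of_int (j - 1)) - 1 / (real m - of_int j))"
    by (simp add: symmetric_kernel_def sum_subtractf algebra_simps)
  also have "\<dots> = 1 / (real m + N + 1) - 1 / (real m - N)"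
    by (subst sum_symmetric_telescope) (simp add: algebra_simps)
  finally show ?thesis by simp
qed

lemma symmetric_kernel_eq:
  "m \<le> N \<Longrightarrow> symmetric_kernel N m = (\<Sum>i<m. 1 / (real i + N + 1) + 1 / (real N - i))"
proof (induction m)
  case 0
  then show ?case by (simp add: symmetric_kernel_0)
next
  case (Suc m)
  have "1 / (real N - real m) = - (1 / (real m - real N))"
    by (metis minus_diff_eq minus_divide_right)
  then show ?case using Suc by (simp add: symmetric_kernel_Suc)
qed

text \<open>For \<open>m \<le> N\<close> the defining sum may have terms of both signs, but
  \<open>symmetric_kernel_eq\<close> rewrites it with positive ones; for \<open>m > N\<close> every
  denominator is positive.\<close>

lemma symmetric_kernel_nonneg: "symmetric_kernel N m \<ge> 0"
proof (cases "m \<le> N")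
  case True
  then show ?thesis by (auto simp: symmetric_kernel_eq intro!: sum_nonneg)
next
  case False
  then show ?thesis unfolding symmetric_kernel_def by (intro sum_nonneg) auto
qed

text \<open>In \<open>symmetric_kernel_eq\<close> with \<open>m = N\<close> the summands
  \<open>1 / (N - i)\<close> are the terms of the harmonic sum in reverse order, and the others are
  positive.\<close>

lemma symmetric_kernel_ge_harm: "symmetric_kernel N N \<ge> harm N"
proof -
  have "harm N = (\<Sum>i<N. 1 / real (Suc i))"
    by (simp add: harm_def inverse_eq_divide sum.atLeast1_atMost_eq)
  also have "\<dots> = (\<Sum>i<N. 1 / real (Suc (N - Suc i)))"
    by (rule sum.nat_diff_reindex[symmetric])
  also have "\<dots> = (\<Sum>i<N. 1 / (real N - i))"
    by (intro sum.cong) (auto simp: of_nat_diff)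
  also have "\<dots> \<le> (\<Sum>i<N. 1 / (real i + N + 1) + 1 / (real N - i))"
    by (intro sum_mono) simp
  also have "\<dots> = symmetric_kernel N N" by (simp add: symmetric_kernel_eq)
  finally show ?thesis .
qed

section \<open>Fourier sums of the modulated sawtooth\<close>

definition fourier_coeff :: "(real \<Rightarrow> complex) \<Rightarrow> int \<Rightarrow> complex" where
  "fourier_coeff f n = (\<integral>x. f x * expo (- n) x \<partial>unit_lebesgue)"

definition fourier_sum :: "(int \<Rightarrow> complex) \<Rightarrow> nat \<Rightarrow> real \<Rightarrow> complex" where
  "fourier_sum c N x = (\<Sum>n = - int N..int N. c n * expo n x)"

definition modulated_sawtooth :: "(nat \<Rightarrow> nat) \<Rightarrow> real \<Rightarrow> complex" where
  "modulated_sawtooth m x = of_real (1/2 - x) * (\<Sum>k. (1/2)^k * expo (int (m k)) x)"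

lemma summable_modulation: "summable (\<lambda>k. norm ((1/2)^k * expo (int (m k)) x))"
  by (simp add: norm_mult norm_power summable_geometric)

lemma measurable_modulated_sawtooth: "modulated_sawtooth m \<in> borel_measurable borel"
  unfolding modulated_sawtooth_def by measurable

lemma norm_modulated_sawtooth_le:
  assumes "x \<in> {0..<1}"
  shows "cmod (modulated_sawtooth m x) \<le> 1"
proof -
  have "cmod (\<Sum>k. (1/2)^k * expo (int (m k)) x) \<le> (\<Sum>k. norm ((1/2)^k * expo (int (m k)) x))"
    by (rule summable_norm[OF summable_modulation])
  also have "\<dots> = 2" by (simp add: norm_mult norm_power suminf_geometric)
  finally have "cmod (\<Sum>k. (1/2)^k * expo (int (m k)) x) \<le> 2" .
  moreover have "cmod (of_real (1/2 - x)) \<le> 1/2" using assms unfolding norm_of_real abs_le_iff by simp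
  ultimately have "cmod (modulated_sawtooth m x) \<le> (1/2) * 2"
    unfolding modulated_sawtooth_def norm_mult by (intro mult_mono) auto
  then show ?thesis by simp
qed

text \<open>Multiplication by \<open>expo (m k)\<close> shifts the coefficients of the sawtooth by
  \<open>m k\<close>; the bound \<open>(1/2)^k\<close> permits termwise integration.\<close>

lemma modulated_sawtooth_coeff:
  "(\<lambda>k. (1/2)^k * (1 / (2 * of_real pi * \<i> * of_int (n - int (m k))))) sums fourier_coeff (modulated_sawtooth m) n"
proof -
  let ?g = "\<lambda>k x. (1/2)^k * (of_real (1/2 - x) * expo (- (n - int (m k))) x)"
  have "continuous_on {0..1} (\<lambda>x. of_real (1/2 - x) * expo j x)" for j
    by (intro continuous_intros continuous_on_expo)
  note I = integral_unit_lebesgue[OF this sawtooth_coefficient]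
  have int: "integrable unit_lebesgue (?g k)" for k
    by (intro integrable_mult_right I)
  have norm_le: "norm (?g k x) \<le> (1/2)^k" if "x \<in> {0..<1}" for k x
  proof -
    have "\<bar>1/2 - x\<bar> \<le> 1" using that by auto
    then have "norm (?g k x) \<le> (1/2)^k * (1 * 1)"
      unfolding norm_mult norm_power norm_of_real norm_expo by (intro mult_mono) auto
    then show ?thesis by simp
  qed
  have sum1: "AE x in unit_lebesgue. summable (\<lambda>k. norm (?g k x))"
    by (intro AE_I2 summable_comparison_test_ev[OF always_eventually summable_geometric[of "1/2::real"]])
       (use norm_le in \<open>auto simp: space_restrict_space\<close>)
  have sum2: "summable (\<lambda>k. \<integral>x. norm (?g k x) \<partial>unit_lebesgue)"
  proof (rule summable_comparison_test_ev[OF always_eventually summable_geometric[of "1/2::real"]])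
    have "(\<integral>x. norm (?g k x) \<partial>unit_lebesgue) \<le> (\<integral>x. (1/2)^k \<partial>unit_lebesgue)" for k
      using norm_le int
      by (intro integral_mono) (auto simp: space_restrict_space integrable_restrict_space)
    then show "\<forall>k. norm (\<integral>x. norm (?g k x) \<partial>unit_lebesgue) \<le> (1/2)^k"
      by (simp add: measure_restrict_space)
  qed simp
  have "(\<lambda>k. integral\<^sup>L unit_lebesgue (?g k)) sums (\<integral>x. (\<Sum>k. ?g k x) \<partial>unit_lebesgue)"
    by (rule sums_integral[OF int sum1 sum2])
  moreover have "(\<Sum>k. ?g k x) = modulated_sawtooth m x * expo (- n) x" for x
  proof -
    have "?g k x = (of_real (1/2 - x) * expo (- n) x) * ((1/2)^k * expo (int (m k)) x)" for k
    proof -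
      have "expo (- (n - int (m k))) x = expo (- n) x * expo (int (m k)) x"
        by (simp flip: expo_add)
      then show ?thesis by (simp add: mult_ac)
    qed
    then have "(\<Sum>k. ?g k x) = (of_real (1/2 - x) * expo (- n) x) * (\<Sum>k. (1/2)^k * expo (int (m k)) x)"
      by (simp only: suminf_mult[OF summable_norm_cancel[OF summable_modulation]])
    then show ?thesis by (simp add: modulated_sawtooth_def mult_ac)
  qed
  moreover have "integral\<^sup>L unit_lebesgue (?g k) = (1/2)^k * (1 / (2 * of_real pi * \<i> * of_int (n - int (m k))))" for k
    by (simp only: integral_mult_right_zero I)
  ultimately show ?thesis by (simp only: fourier_coeff_def)
qed

text \<open>At \<open>0\<close> every term of the series is \<open>\<i>\<close> times a nonnegative
  real, so nothing cancels and the imaginary part of the sum dominates each single term.\<close>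

lemma modulated_sawtooth_fourier_sum:
  "cmod (fourier_sum (fourier_coeff (modulated_sawtooth m)) N 0) \<ge> (1/2)^k * symmetric_kernel N (m k) / (2 * pi)"
proof -
  let ?a = "\<lambda>k. (1/2)^k * symmetric_kernel N (m k) / (2 * pi)"
  have "(\<lambda>k. \<Sum>n = - int N..int N. (1/2)^k * (1 / (2 * of_real pi * \<i> * of_int (n - int (m k)))))
      sums (\<Sum>n = - int N..int N. fourier_coeff (modulated_sawtooth m) n)"
    by (intro sums_sum modulated_sawtooth_coeff)
  moreover have "(\<Sum>n = - int N..int N. (1/2)^k * (1 / (2 * of_real pi * \<i> * of_int (n - int (m k))))) = \<i> * of_real (?a k)" for k
  proof -
    \<comment> \<open>\<open>1 / \<i> = - \<i>\<close> reverses the sign of \<open>n - m k\<close>,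
      which produces the kernel; at \<open>n = m k\<close> both sides are \<open>0\<close>.\<close>
    have "1 / (2 * of_real pi * \<i> * of_int (n - int (m k))) = \<i> / (2 * of_real pi) * of_real (1 / (real (m k) - of_int n))" for n
    proof -
      have "1 / (2 * of_real pi * \<i> * z) = \<i> / (2 * of_real pi) * (1 / (- z))" for z
        by (cases "z = 0") (simp_all add: field_simps)
      from this[of "of_int (n - int (m k))"] show ?thesis by simp
    qed
    then show ?thesis
      by (simp add: symmetric_kernel_def sum_distrib_left sum_divide_distrib mult_ac)
  qed
  moreover have "fourier_sum c N 0 = (\<Sum>n = - int N..int N. c n)" for c
    by (simp add: fourier_sum_def)
  ultimately have s: "(\<lambda>k. \<i> * of_real (?a k)) sums fourier_sum (fourier_coeff (modulated_sawtooth m)) N 0"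
    by simp
  have "(\<lambda>k. Im (\<i> * of_real (?a k))) sums Im (fourier_sum (fourier_coeff (modulated_sawtooth m)) N 0)"
    by (rule sums_Im[OF s])
  then have r: "?a sums Im (fourier_sum (fourier_coeff (modulated_sawtooth m)) N 0)" by simp
  have "?a k = sum ?a {k}" by simp
  also have "\<dots> \<le> suminf ?a"
    using sums_summable[OF r] symmetric_kernel_nonneg by (intro sum_le_suminf) auto
  also have "\<dots> = Im (fourier_sum (fourier_coeff (modulated_sawtooth m)) N 0)"
    using r by (simp add: sums_iff)
  also have "\<dots> \<le> cmod (fourier_sum (fourier_coeff (modulated_sawtooth m)) N 0)"
    using abs_Im_le_cmod order_trans abs_ge_self by blast
  finally show ?thesis .
qed

lemma exists_unbounded_fourier_sums:
  "\<exists>m. \<forall>k. cmod (fourier_sum (fourier_coeff (modulated_sawtooth m)) (m k) 0) \<ge> 2 * 2^k"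
proof -
  \<comment> \<open>\<open>2 * pi\<close> and the last \<open>2^k\<close> undo the normalisation and
    the weight \<open>(1/2)^k\<close>. What remains is \<open>2 * 2^k\<close>, twice the size wanted
    near \<open>0\<close>.\<close>
  have "\<exists>N. harm N \<ge> 2 * 2^k * (2 * pi) * (2::real)^k" for k :: nat
    using harm_at_top unfolding filterlim_at_top eventually_sequentially by blast
  then obtain m where m: "\<And>k. harm (m k) \<ge> 2 * 2^k * (2 * pi) * (2::real)^k" by metis
  have "2 * 2^k \<le> cmod (fourier_sum (fourier_coeff (modulated_sawtooth m)) (m k) 0)" for k
  proof -
    have "2 * 2^k = (1/2)^k * (2 * 2^k * (2 * pi) * 2^k) / (2 * pi)"
      by (simp add: power_divide)
    also have "\<dots> \<le> (1/2)^k * symmetric_kernel (m k) (m k) / (2 * pi)"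
      using m[of k] symmetric_kernel_ge_harm[of "m k"]
      by (intro divide_right_mono mult_left_mono) auto
    also note modulated_sawtooth_fourier_sum
    finally show ?thesis .
  qed
  then show ?thesis by blast
qed

subsection \<open>Fourier coefficients\<close>

interpretation unit_lebesgue: circle_measure unit_lebesgue
proof (intro circle_measure.intro finite_measureI circle_measure_axioms.intro)
  show "emeasure unit_lebesgue (space unit_lebesgue) \<noteq> \<infinity>"
    by (simp add: emeasure_restrict_space space_restrict_space)
  show "sets unit_lebesgue = sets (restrict_space borel {0..<1})"
    by (rule sets_restrict_space_cong) simp
qed

lemma fourier_sum_trig_poly: "fourier_sum c N \<in> trig_polys"
proof -
  have "(\<lambda>x. \<Sum>n\<in>I. c n * expo n x) \<in> trig_polys" if "finite I" for I
    using that
    by (induction I rule: finite_induct) (simp_all add: trig_polys_const trig_polys.intros)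
  from this[of "{- int N..int N}"] show ?thesis by (simp add: fourier_sum_def[abs_def])
qed

lemma continuous_on_fourier_sum: "continuous_on A (fourier_sum c N)"
  unfolding fourier_sum_def by (intro continuous_intros continuous_on_expo)

lemma fourier_coeff_fourier_sum:
  assumes "\<bar>n\<bar> \<le> int N"
  shows "fourier_coeff (fourier_sum c N) n = c n"
proof -
  have int: "integrable unit_lebesgue (\<lambda>x. c k * (expo k x * cnj (expo n x)))" for k
  proof -
    have "(\<lambda>x. c k * (expo k x * cnj (expo n x))) = (\<lambda>x. c k * expo (k - n) x)"
      by (simp add: cnj_expo flip: expo_add)
    then show ?thesis
      using integral_unit_lebesgue(2)[OF continuous_on_expo expo_integral_0_1] by simp
  qed
  have "fourier_coeff (fourier_sum c N) n
      = (\<integral>x. (\<Sum>k = - int N..int N. c k * (expo k x * cnj (expo n x))) \<partial>unit_lebesgue)"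
    by (simp add: fourier_coeff_def fourier_sum_def sum_distrib_right cnj_expo mult.assoc)
  also have "\<dots> = (\<Sum>k = - int N..int N. c k * (if k = n then 1 else 0))"
    by (simp only: Bochner_Integration.integral_sum[OF int] integral_mult_right_zero expo_orthonormal)
  also have "\<dots> = c n" using assms by (simp add: abs_le_iff if_distrib cong: if_cong)
  finally show ?thesis .
qed

text \<open>The total mass is finite, so \<open>1 + (cmod (f x))\<^sup>2\<close> is an integrable
  majorant.\<close>

lemma L2_imp_integrable_unit_lebesgue:
  assumes "f \<in> L2 unit_lebesgue"
  shows "integrable unit_lebesgue f"
proof (rule Bochner_Integration.integrable_bound)
  show "integrable unit_lebesgue (\<lambda>x. 1 + (cmod (f x))\<^sup>2)"
    using L2_integrable[OF assms] by simp
  have "t \<le> 1 + t\<^sup>2" for t :: real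
    using zero_le_power2[of "t - 1/2"] by (simp add: power2_eq_square algebra_simps)
  then show "AE x in unit_lebesgue. norm (f x) \<le> norm (1 + (cmod (f x))\<^sup>2)" by simp
qed (rule L2_measurable[OF assms])

text \<open>The total mass is \<open>1\<close>, so nonnegativity of the variance of
  \<open>cmod (f x)\<close> bounds its mean \<open>a\<close> by the norm, as Cauchy-Schwarz
  would.\<close>

lemma norm_fourier_coeff_le:
  assumes f: "f \<in> L2 unit_lebesgue"
  shows "cmod (fourier_coeff f n) \<le> L2_norm unit_lebesgue f"
proof -
  define a where "a = (\<integral>x. cmod (f x) \<partial>unit_lebesgue)"
  have i: "integrable unit_lebesgue (\<lambda>x. cmod (f x))" "integrable unit_lebesgue (\<lambda>x. (cmod (f x))\<^sup>2)"
    using L2_imp_integrable_unit_lebesgue[OF f] L2_integrable[OF f] by auto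
  have "0 \<le> (\<integral>x. (cmod (f x) - a)\<^sup>2 \<partial>unit_lebesgue)" by simp
  also have "\<dots> = (\<integral>x. (cmod (f x))\<^sup>2 - 2 * a * cmod (f x) + a\<^sup>2 \<partial>unit_lebesgue)"
    by (simp add: power2_diff algebra_simps)
  also have "\<dots> = (\<integral>x. (cmod (f x))\<^sup>2 \<partial>unit_lebesgue) - 2 * a * a + a\<^sup>2"
    using i by (simp add: a_def[symmetric] measure_restrict_space space_restrict_space)
  finally have "a \<le> L2_norm unit_lebesgue f"
    unfolding L2_norm_def by (intro real_le_rsqrt) (simp add: power2_eq_square)
  moreover have "cmod (fourier_coeff f n) \<le> (\<integral>x. norm (f x * expo (- n) x) \<partial>unit_lebesgue)"
    unfolding fourier_coeff_def by (rule integral_norm_bound)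
  ultimately show ?thesis by (simp add: norm_mult a_def)
qed

lemma fourier_coeff_diff:
  assumes "f \<in> L2 unit_lebesgue" "g \<in> L2 unit_lebesgue"
  shows "fourier_coeff (\<lambda>x. f x - g x) n = fourier_coeff f n - fourier_coeff g n"
proof -
  have *: "integrable unit_lebesgue (\<lambda>x. h x * expo (- n) x)" if "h \<in> L2 unit_lebesgue" for h
  proof (rule Bochner_Integration.integrable_bound)
    show "integrable unit_lebesgue h" by (rule L2_imp_integrable_unit_lebesgue[OF that])
    show "(\<lambda>x. h x * expo (- n) x) \<in> borel_measurable unit_lebesgue"
      by (intro borel_measurable_times L2_measurable[OF that] unit_lebesgue.measurable_M measurable_expo)
  qed (simp add: norm_mult)
  show ?thesis
    unfolding fourier_coeff_def left_diff_distrib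
    by (intro Bochner_Integration.integral_diff * assms)
qed

subsection \<open>Weighted spaces\<close>

text \<open>The bound on \<open>d\<close> leaves only finitely many nonzero terms in the series for \<open>w\<close> at each point.\<close>
lemma exists_singular_weight:
  fixes d :: "nat \<Rightarrow> real"
  assumes d: "\<And>k. 0 < d k" "\<And>k. d k \<le> 1 / Suc k"
  obtains w :: "real \<Rightarrow> real" where "w \<in> borel_measurable borel" "\<And>x. 1 \<le> w x"
    "integrable unit_lebesgue w" "\<And>k x. x \<in> {0<..<d k} \<Longrightarrow> 1 / (2^k * d k) \<le> w x"
proof
  \<comment> \<open>Height \<open>1 / (2^k * d k)\<close> on an interval of length
    \<open>d k\<close> gives mass \<open>(1/2)^k\<close>, summable however small the
    \<open>d k\<close> are.\<close>
  define b where "b k x = 1 / (2^k * d k) * indicator {0<..<d k} x" for k x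
  define w where "w x = 1 + (\<Sum>k. b k x)" for x
  have b0: "b k x \<ge> 0" for k x using d(1)[of k] by (simp add: b_def)
  have [measurable]: "b k \<in> borel_measurable borel" for k unfolding b_def by measurable
  have sumb: "summable (\<lambda>k. b k x)" for x
  proof (cases "x > 0")
    case True
    then obtain K where K: "inverse (real (Suc K)) < x" using reals_Archimedean by blast
    have "b k x = 0" if "k \<notin> {..<K}" for k
    proof -
      have "d k \<le> inverse (real (Suc K))"
        using d(2)[of k] that by (auto simp: inverse_eq_divide intro!: order_trans[OF d(2)] divide_left_mono)
      then show ?thesis using K by (simp add: b_def)
    qed
    then show ?thesis by (intro summable_finite[of "{..<K}"]) auto
  next
    case False
    then show ?thesis by (simp add: b_def)
  qed
  have pos: "(\<Sum>k. b k x) \<ge> 0" for x by (intro suminf_nonneg sumb b0)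
  show [measurable]: "w \<in> borel_measurable borel" unfolding w_def by measurable
  then have wR: "w \<in> borel_measurable unit_lebesgue" by (simp add: measurable_restrict_space1)
  show "1 \<le> w x" for x using pos by (simp add: w_def)
  show "1 / (2^k * d k) \<le> w x" if "x \<in> {0<..<d k}" for k x
  proof -
    have "1 / (2^k * d k) = sum (\<lambda>k. b k x) {k}" using that by (simp add: b_def)
    also have "\<dots> \<le> (\<Sum>k. b k x)" using sumb b0 by (intro sum_le_suminf) auto
    finally show ?thesis by (simp add: w_def)
  qed
  have nb: "(\<integral>\<^sup>+x. ennreal (b k x) \<partial>unit_lebesgue) \<le> ennreal ((1/2)^k)" for k
  proof -
    have "(\<integral>\<^sup>+x. ennreal (b k x) \<partial>unit_lebesgue) = (\<integral>\<^sup>+x. ennreal (b k x) * indicator {0..<1} x \<partial>lborel)"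
      by (simp add: nn_integral_restrict_space)
    also have "\<dots> \<le> (\<integral>\<^sup>+x. ennreal (1 / (2^k * d k)) * indicator {0<..<d k} x \<partial>lborel)"
      by (intro nn_integral_mono) (auto simp: b_def split: split_indicator)
    also have "\<dots> = ennreal (1 / (2^k * d k)) * ennreal (d k)"
      using d(1)[of k] by (subst nn_integral_cmult_indicator) (auto simp: less_imp_le)
    also have "\<dots> = ennreal ((1/2)^k)"
      using d(1)[of k] by (simp flip: ennreal_mult add: power_divide)
    finally show ?thesis .
  qed
  show "integrable unit_lebesgue w"
  proof (rule integrableI_bounded[OF wR])
    have "(\<integral>\<^sup>+x. ennreal (norm (w x)) \<partial>unit_lebesgue) = (\<integral>\<^sup>+x. 1 + (\<Sum>k. ennreal (b k x)) \<partial>unit_lebesgue)"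
    proof (intro nn_integral_cong)
      fix x
      have "ennreal (norm (w x)) = ennreal (1 + (\<Sum>k. b k x))" using pos[of x] by (simp add: w_def)
      also have "\<dots> = 1 + ennreal (\<Sum>k. b k x)" using pos[of x] by (simp add: ennreal_plus)
      also have "ennreal (\<Sum>k. b k x) = (\<Sum>k. ennreal (b k x))"
        using suminf_ennreal2[of "\<lambda>k. b k x", OF b0 sumb] by simp
      finally show "ennreal (norm (w x)) = 1 + (\<Sum>k. ennreal (b k x))" .
    qed
    also have "\<dots> = 1 + (\<Sum>k. \<integral>\<^sup>+x. ennreal (b k x) \<partial>unit_lebesgue)"
      by (subst nn_integral_add)
         (auto simp: nn_integral_suminf emeasure_restrict_space space_restrict_space measurable_restrict_space1)
    also have "\<dots> \<le> 1 + (\<Sum>k. ennreal ((1/2)^k))"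
      by (intro add_left_mono suminf_le nb) auto
    also have "(\<Sum>k. ennreal ((1/2)^k)) = ennreal 2"
    proof -
      have "(\<Sum>k. ennreal ((1/2)^k)) = ennreal (\<Sum>k. (1/2)^k)"
        by (intro suminf_ennreal2 summable_geometric) auto
      also have "(\<Sum>k. (1/2)^k) = (2::real)" by (simp add: suminf_geometric)
      finally show ?thesis .
    qed
    also have "1 + ennreal 2 < \<infinity>" by simp
    finally show "(\<integral>\<^sup>+x. ennreal (norm (w x)) \<partial>unit_lebesgue) < \<infinity>" .
  qed
qed

locale weight =
  fixes w :: "real \<Rightarrow> real"
  assumes measurable_w [measurable]: "w \<in> borel_measurable borel"
    and w_ge_1: "1 \<le> w x"
    and integrable_w: "integrable unit_lebesgue w"
begin

definition \<mu> :: "real measure" where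
  "\<mu> = density unit_lebesgue (\<lambda>x. ennreal (w x))"

lemma w_pos: "0 < w x" "0 \<le> w x"
  using w_ge_1[of x] by simp_all

lemma measurable_w_unit: "w \<in> borel_measurable unit_lebesgue"
  by (rule unit_lebesgue.measurable_M[OF measurable_w])

sublocale circle_measure \<mu>
proof (intro circle_measure.intro finite_measureI circle_measure_axioms.intro)
  have "emeasure \<mu> (space \<mu>) = (\<integral>\<^sup>+x. ennreal (w x) * indicator (space unit_lebesgue) x \<partial>unit_lebesgue)"
    unfolding \<mu>_def space_density
    by (rule emeasure_density[OF measurable_compose[OF measurable_w_unit measurable_ennreal] sets.top])
  also have "\<dots> = (\<integral>\<^sup>+x. ennreal (w x) \<partial>unit_lebesgue)"
    by (intro nn_integral_cong) (simp add: indicator_def)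
  also have "\<dots> = ennreal (\<integral>x. w x \<partial>unit_lebesgue)"
    by (intro nn_integral_eq_integral integrable_w) (simp add: w_pos)
  finally show "emeasure \<mu> (space \<mu>) \<noteq> \<infinity>" by simp
  show "sets \<mu> = sets (restrict_space borel {0..<1})"
    by (simp add: \<mu>_def unit_lebesgue.sets_M)
qed

lemma measurable_\<mu>_iff: "f \<in> borel_measurable \<mu> \<longleftrightarrow> f \<in> borel_measurable unit_lebesgue"
  by (simp add: \<mu>_def)

lemma integral_\<mu>:
  fixes f :: "real \<Rightarrow> 'a::{banach, second_countable_topology}"
  assumes "f \<in> borel_measurable unit_lebesgue"
  shows "integral\<^sup>L \<mu> f = (\<integral>x. w x *\<^sub>R f x \<partial>unit_lebesgue)"
  unfolding \<mu>_def by (intro integral_density assms measurable_w_unit AE_I2 w_pos)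

lemma integrable_\<mu>_iff:
  fixes f :: "real \<Rightarrow> 'a::{banach, second_countable_topology}"
  assumes "f \<in> borel_measurable unit_lebesgue"
  shows "integrable \<mu> f \<longleftrightarrow> integrable unit_lebesgue (\<lambda>x. w x *\<^sub>R f x)"
  unfolding \<mu>_def by (intro integrable_density assms measurable_w_unit AE_I2 w_pos)

text \<open>\<open>w \<ge> 1\<close> makes the weighted norm the larger one. Convergence for
  \<open>\<mu>\<close> thereby controls Fourier coefficients, which are integrals for Lebesgue
  measure.\<close>

lemma L2_\<mu>_imp_L2_unit:
  assumes "f \<in> L2 \<mu>"
  shows "f \<in> L2 unit_lebesgue" "L2_norm unit_lebesgue f \<le> L2_norm \<mu> f"
proof -
  have m: "f \<in> borel_measurable unit_lebesgue"
    using L2_measurable[OF assms] by (simp add: measurable_\<mu>_iff)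
  then have m2: "(\<lambda>x. (cmod (f x))\<^sup>2) \<in> borel_measurable unit_lebesgue" by measurable
  have i: "integrable unit_lebesgue (\<lambda>x. w x * (cmod (f x))\<^sup>2)"
    using L2_integrable[OF assms] by (simp add: integrable_\<mu>_iff[OF m2])
  have le: "(cmod (f x))\<^sup>2 \<le> w x * (cmod (f x))\<^sup>2" for x
    using mult_right_mono[OF w_ge_1[of x], of "(cmod (f x))\<^sup>2"] by simp
  show L: "f \<in> L2 unit_lebesgue" by (rule L2_dominated[OF m i le])
  show "L2_norm unit_lebesgue f \<le> L2_norm \<mu> f"
    unfolding L2_norm_def integral_\<mu>[OF m2]
    using le i L2_integrable[OF L] by (auto intro!: integral_mono)
qed

section \<open>The positive operator and its orthonormal basis\<close>

definition B :: "(real \<Rightarrow> complex) \<Rightarrow> real \<Rightarrow> complex" where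
  "B f x = f x / of_real (sqrt (w x))"

lemma norm_B_le: "cmod (B f x) \<le> cmod (f x)"
  using w_ge_1[of x] mult_left_mono[of 1 "sqrt (w x)" "cmod (f x)"]
  by (simp add: B_def norm_divide divide_le_eq)

lemma B_L2:
  assumes "f \<in> L2 \<mu>"
  shows "B f \<in> L2 \<mu>"
proof (rule L2_dominated[OF _ L2_integrable[OF assms]])
  have [measurable]: "f \<in> borel_measurable \<mu>" "w \<in> borel_measurable \<mu>"
    using L2_measurable[OF assms] measurable_M[OF measurable_w] by auto
  show "B f \<in> borel_measurable \<mu>" unfolding B_def[abs_def] by measurable
  show "(cmod (B f x))\<^sup>2 \<le> (cmod (f x))\<^sup>2" for x by (intro power_mono norm_B_le) simp
qed

lemma B_bounded_operator: "L2_bounded_operator \<mu> B"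
  unfolding L2_bounded_operator_def
proof (intro conjI ballI allI impI)
  have "L2_norm \<mu> (B f) \<le> 1 * L2_norm \<mu> f" if "f \<in> L2 \<mu>" for f
    using B_L2[OF that] that
    by (auto simp: L2_norm_def intro!: integral_mono L2_integrable power_mono norm_B_le)
  then show "\<exists>C. \<forall>f\<in>L2 \<mu>. L2_norm \<mu> (B f) \<le> C * L2_norm \<mu> f" by blast
qed (auto simp: B_def B_L2 add_divide_distrib elim: eventually_mono)

lemma B_positive: "L2_positive_semidefinite \<mu> B"
  unfolding L2_positive_semidefinite_def L2_self_adjoint_def
proof (intro conjI ballI)
  fix f g
  show "L2_inner \<mu> (B f) g = L2_inner \<mu> f (B g)"
    by (simp add: L2_inner_def B_def)
  have "B f x * cnj (f x) = of_real ((cmod (f x))\<^sup>2 / sqrt (w x))" for x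
    unfolding of_real_divide complex_norm_square by (simp add: B_def)
  then have "L2_inner \<mu> (B f) f = of_real (\<integral>x. (cmod (f x))\<^sup>2 / sqrt (w x) \<partial>\<mu>)"
    by (simp only: L2_inner_def integral_complex_of_real)
  moreover have "(\<integral>x. (cmod (f x))\<^sup>2 / sqrt (w x) \<partial>\<mu>) \<ge> 0"
    by (intro integral_nonneg_AE) (simp add: w_pos)
  ultimately show "L2_inner \<mu> (B f) f \<in> \<real>\<^sub>\<ge>\<^sub>0" by simp
qed

lemma expo_L2: "expo n \<in> L2 \<mu>"
  by (rule L2_bounded[where C = 1]) (simp_all add: measurable_M)

text \<open>In inner products the two factors \<open>1 / sqrt (w x)\<close> cancel the weight. For
  density, approximating \<open>f\<close> by \<open>B p\<close> in the weighted space amounts to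
  approximating \<open>sqrt w * f\<close> by \<open>p\<close> in the Lebesgue space.\<close>

lemma B_expo_orthonormal_basis: "L2_orthonormal_basis \<mu> (\<lambda>n. B (expo n))"
  unfolding L2_orthonormal_basis_def
proof (intro conjI ballI allI impI)
  show "B (expo n) \<in> L2 \<mu>" for n by (intro B_L2 expo_L2)
  have [measurable]: "B (expo n) \<in> borel_measurable unit_lebesgue" for n
    using L2_measurable[OF B_L2[OF expo_L2]] by (simp add: measurable_\<mu>_iff)
  have sq: "w x = sqrt (w x) * sqrt (w x)" for x by (simp add: w_pos)
  show "L2_inner \<mu> (B (expo n)) (B (expo m)) = (if n = m then 1 else 0)" for n m
  proof -
    have "w x *\<^sub>R (B (expo n) x * cnj (B (expo m) x)) = expo n x * cnj (expo m x)" for x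
    proof -
      have "complex_of_real (w x) = of_real (sqrt (w x)) * of_real (sqrt (w x))"
        by (metis sq of_real_mult)
      then show ?thesis using w_pos(1)[of x] by (simp add: B_def scaleR_conv_of_real)
    qed
    moreover have "(\<lambda>x. B (expo n) x * cnj (B (expo m) x)) \<in> borel_measurable unit_lebesgue"
    proof -
      have [measurable]: "cnj \<in> borel_measurable borel"
        by (intro borel_measurable_continuous_onI continuous_intros)
      show ?thesis by measurable
    qed
    ultimately show ?thesis by (simp add: L2_inner_def integral_\<mu> expo_orthonormal)
  qed
  fix f and \<epsilon> :: real assume f: "f \<in> L2 \<mu>" and "\<epsilon> > 0"
  let ?g = "\<lambda>x. of_real (sqrt (w x)) * f x"
  have [measurable]: "f \<in> borel_measurable unit_lebesgue" "w \<in> borel_measurable unit_lebesgue"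
    using f measurable_w_unit by (auto dest: L2_measurable simp: measurable_\<mu>_iff)
  have "?g \<in> L2 unit_lebesgue"
  proof (rule L2_dominated)
    show "?g \<in> borel_measurable unit_lebesgue" by measurable
    show "integrable unit_lebesgue (\<lambda>x. w x * (cmod (f x))\<^sup>2)"
      using L2_integrable[OF f] by (simp add: integrable_\<mu>_iff)
    show "(cmod (?g x))\<^sup>2 \<le> w x * (cmod (f x))\<^sup>2" for x
      using w_pos(2)[of x] by (simp add: norm_mult power_mult_distrib)
  qed
  then obtain p where p: "p \<in> trig_polys" "(\<integral>x. (cmod (?g x - p x))\<^sup>2 \<partial>unit_lebesgue) < \<epsilon>\<^sup>2"
    using unit_lebesgue.trig_polys_dense_L2[of ?g] \<open>\<epsilon> > 0\<close> unfolding trig_approximable_def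
    by (meson zero_less_power)
  have [measurable]: "p \<in> borel_measurable unit_lebesgue"
    by (intro unit_lebesgue.measurable_M measurable_trig_polys p)
  have [measurable]: "B p \<in> borel_measurable unit_lebesgue" unfolding B_def[abs_def] by measurable
  from trig_polys_sum_form[OF p(1)] obtain I c where I: "finite I" "p = (\<lambda>x. \<Sum>i\<in>I. c i * expo i x)"
    by blast
  \<comment> \<open>The pointwise form of the isometry between the two spaces.\<close>
  have "w x * (cmod (f x - B p x))\<^sup>2 = (cmod (?g x - p x))\<^sup>2" for x
  proof -
    have "?g x - p x = of_real (sqrt (w x)) * (f x - B p x)"
      using w_pos(1)[of x] by (simp add: B_def right_diff_distrib)
    then show ?thesis using w_pos(2)[of x] by (simp add: norm_mult power_mult_distrib)
  qed
  then have "(\<integral>x. (cmod (f x - B p x))\<^sup>2 \<partial>\<mu>) < \<epsilon>\<^sup>2"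
    using p(2) by (simp add: integral_\<mu>)
  then have "L2_norm \<mu> (\<lambda>x. f x - B p x) < \<epsilon>"
    unfolding L2_norm_def using \<open>\<epsilon> > 0\<close> by (intro real_less_lsqrt) auto
  moreover have "B p x = (\<Sum>i\<in>I. c i * B (expo i) x)" for x
    by (simp add: I(2) B_def sum_divide_distrib)
  ultimately show "\<exists>I c. finite I \<and> L2_norm \<mu> (\<lambda>x. f x - (\<Sum>i\<in>I. c i * B (expo i) x)) < \<epsilon>"
    using I(1) by (intro exI[of _ I] exI[of _ c] conjI) simp_all
qed

text \<open>For \<open>N \<ge> \<bar>n\<bar>\<close> the number
  \<open>c n - fourier_coeff f n\<close> is the \<open>n\<close>-th coefficient of the remainder,
  hence at most its Lebesgue norm, hence at most its weighted norm, which tends to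
  \<open>0\<close>.\<close>

lemma L2_tendsto_imp_fourier_coeff:
  assumes f: "f \<in> L2 \<mu>" and lim: "L2_tendsto \<mu> (fourier_sum c) f"
  shows "c n = fourier_coeff f n"
proof -
  have L: "fourier_sum c N \<in> L2 \<mu>" for N by (intro trig_polys_L2 fourier_sum_trig_poly)
  have "cmod (c n - fourier_coeff f n) \<le> L2_norm \<mu> (\<lambda>x. fourier_sum c N x - f x)" if "nat \<bar>n\<bar> \<le> N" for N
  proof -
    note D = L2_\<mu>_imp_L2_unit[OF L2_diff[OF L[of N] f]]
    have "c n - fourier_coeff f n = fourier_coeff (\<lambda>x. fourier_sum c N x - f x) n"
      using that by (simp add: fourier_coeff_diff L2_\<mu>_imp_L2_unit L f fourier_coeff_fourier_sum)
    then show ?thesis using norm_fourier_coeff_le[OF D(1), of n] D(2) by simp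
  qed
  then have "\<exists>K. \<forall>N\<ge>K. cmod (c n - fourier_coeff f n) \<le> L2_norm \<mu> (\<lambda>x. fourier_sum c N x - f x)"
    by blast
  with lim have "cmod (c n - fourier_coeff f n) \<le> 0"
    unfolding L2_tendsto_def by (rule LIMSEQ_le_const)
  then show ?thesis by simp
qed

text \<open>Stated with squared norms because \<open>integral_\<mu>_ge\<close> estimates these from
  below.\<close>

lemma L2_tendsto_imp_bounded:
  assumes S: "\<And>N. S N \<in> L2 \<mu>" and f: "f \<in> L2 \<mu>" and lim: "L2_tendsto \<mu> S f"
  shows "\<exists>C. \<forall>N. (\<integral>x. (cmod (S N x))\<^sup>2 \<partial>\<mu>) \<le> C"
proof -
  from lim have "Bseq (\<lambda>N. L2_norm \<mu> (\<lambda>x. S N x - f x))"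
    unfolding L2_tendsto_def by (intro convergent_imp_Bseq convergentI)
  then obtain K where K: "\<And>N. norm (L2_norm \<mu> (\<lambda>x. S N x - f x)) \<le> K"
    unfolding Bseq_def by blast
  have "(\<integral>x. (cmod (S N x))\<^sup>2 \<partial>\<mu>) \<le> 2 * K\<^sup>2 + 2 * (\<integral>x. (cmod (f x))\<^sup>2 \<partial>\<mu>)" for N
  proof -
    note I = L2_integrable[OF L2_diff[OF S[of N] f]] L2_integrable[OF f]
    have "(\<integral>x. (cmod (S N x))\<^sup>2 \<partial>\<mu>) \<le> (\<integral>x. 2 * (cmod (S N x - f x))\<^sup>2 + 2 * (cmod (f x))\<^sup>2 \<partial>\<mu>)"
      using norm_add_sq_le[of "S N x - f x" "f x" for x]
      by (intro integral_mono Bochner_Integration.integrable_add integrable_mult_right I L2_integrable[OF S]) auto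
    also have "\<dots> = 2 * (L2_norm \<mu> (\<lambda>x. S N x - f x))\<^sup>2 + 2 * (\<integral>x. (cmod (f x))\<^sup>2 \<partial>\<mu>)"
      using I by (simp add: L2_norm_def)
    also have "(L2_norm \<mu> (\<lambda>x. S N x - f x))\<^sup>2 \<le> K\<^sup>2"
      using power_mono[OF K[of N], of 2] by simp
    finally show ?thesis by simp
  qed
  then show ?thesis by blast
qed

text \<open>Only the integral over \<open>(0,d)\<close> is kept: length \<open>d\<close> times
  weight \<open>a / d\<close> gives mass at least \<open>a\<close>, carrying the value
  \<open>b\<^sup>2\<close>. The bound \<open>d \<le> 1\<close> keeps the interval inside
  \<open>[0,1)\<close>.\<close>

lemma integral_\<mu>_ge:
  assumes d: "0 < d" "d \<le> 1" and g: "g \<in> L2 \<mu>"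
    and ge: "\<And>x. x \<in> {0<..<d} \<Longrightarrow> a / d \<le> w x" "\<And>x. x \<in> {0<..<d} \<Longrightarrow> b \<le> cmod (g x)"
    and ab: "0 \<le> a" "0 \<le> b"
  shows "a * b\<^sup>2 \<le> (\<integral>x. (cmod (g x))\<^sup>2 \<partial>\<mu>)"
proof -
  have m: "(\<lambda>x. (cmod (g x))\<^sup>2) \<in> borel_measurable unit_lebesgue"
    using L2_measurable[OF g] by (simp add: measurable_\<mu>_iff)
  have "{0<..<d} \<subseteq> {0..<1}" using d by auto
  then have D: "{0<..<d} \<in> sets unit_lebesgue" "measure unit_lebesgue {0<..<d} = d"
    using d by (auto simp: sets_restrict_space_iff measure_restrict_space)
  have "a * b\<^sup>2 = (\<integral>x. (a / d * b\<^sup>2) * indicator {0<..<d} x \<partial>unit_lebesgue)"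
    using D d by (simp add: Int_absorb2[OF \<open>{0<..<d} \<subseteq> {0..<1}\<close>])
  also have "\<dots> \<le> (\<integral>x. w x * (cmod (g x))\<^sup>2 \<partial>unit_lebesgue)"
  proof (intro integral_mono)
    show "integrable unit_lebesgue (\<lambda>x. (a / d * b\<^sup>2) * indicator {0<..<d} x)"
      by (intro integrable_mult_right integrable_real_indicator D(1))
         (simp only: infinity_ennreal_def top.not_eq_extremum[symmetric] unit_lebesgue.emeasure_finite not_False_eq_True)
    show "integrable unit_lebesgue (\<lambda>x. w x * (cmod (g x))\<^sup>2)"
      using L2_integrable[OF g] by (simp add: integrable_\<mu>_iff[OF m])
    show "(a / d * b\<^sup>2) * indicator {0<..<d} x \<le> w x * (cmod (g x))\<^sup>2" for x
    proof (cases "x \<in> {0<..<d}")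
      case True
      have "a / d * b\<^sup>2 \<le> w x * (cmod (g x))\<^sup>2"
        using ge[OF True] ab w_pos(2) by (intro mult_mono power_mono) auto
      then show ?thesis using True by simp
    next
      case False
      then show ?thesis using w_pos(2)[of x] by simp
    qed
  qed
  also have "\<dots> = (\<integral>x. (cmod (g x))\<^sup>2 \<partial>\<mu>)" by (simp add: integral_\<mu>[OF m])
  finally show ?thesis .
qed

end

section \<open>Choice of frequencies, intervals and weight\<close>

theorem theorem4p2:
  "\<exists>\<mu> :: real measure.
     sets \<mu> = sets (restrict_space borel {0..<1}) \<and>
     absolutely_continuous (restrict_space lborel {0..<1}) \<mu> \<and>
     (\<forall>n. expo n \<in> L2 \<mu>) \<and>
     (\<exists>f\<in>L2 \<mu>. \<not> (\<exists>c :: int \<Rightarrow> complex.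
        L2_tendsto \<mu> (\<lambda>M x. \<Sum>n = - int M..int M. c n * expo n x) f)) \<and>
     (\<exists>B. L2_bounded_operator \<mu> B \<and> L2_positive_semidefinite \<mu> B \<and>
        L2_orthonormal_basis \<mu> (\<lambda>n. B (expo n)))"
proof -
  from exists_unbounded_fourier_sums obtain m where
    m: "\<And>k. cmod (fourier_sum (fourier_coeff (modulated_sawtooth m)) (m k) 0) \<ge> 2 * 2^k"
    by blast
  define f where "f = modulated_sawtooth m"
  define T where "T k = fourier_sum (fourier_coeff f) (m k)" for k
  \<comment> \<open>The value at \<open>0\<close> has modulus at least \<open>2 * 2^k\<close>; by
    continuity less than \<open>2^k\<close> is lost on a short interval.\<close>
  have "\<exists>d. 0 < d \<and> d \<le> 1 / Suc k \<and> (\<forall>x\<in>{0<..<d}. 2^k \<le> cmod (T k x))" for k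
  proof -
    have "isCont (T k) 0"
      unfolding T_def using continuous_on_fourier_sum[of UNIV] by (simp add: continuous_on_eq_continuous_at)
    then obtain e where e: "e > 0" "\<And>x. dist x 0 < e \<Longrightarrow> dist (T k x) (T k 0) < 2^k"
      unfolding continuous_at_eps_delta by (metis zero_less_numeral zero_less_power)
    have "2^k \<le> cmod (T k x)" if "x \<in> {0<..<e}" for x
      using e(2)[of x] that m[of k] norm_triangle_ineq2[of "T k 0" "T k x"]
      by (simp add: T_def f_def dist_norm norm_minus_commute)
    \<comment> \<open>The minimum with \<open>1 / Suc k\<close> supplies the decay that
      \<open>exists_singular_weight\<close> asks for.\<close>
    then show ?thesis using e(1) by (intro exI[of _ "min e (1 / Suc k)"]) auto
  qed
  then obtain d where d: "\<And>k. 0 < d k" "\<And>k. d k \<le> 1 / Suc k"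
    and dT: "\<And>k x. x \<in> {0<..<d k} \<Longrightarrow> 2^k \<le> cmod (T k x)" by metis
  obtain w where w: "w \<in> borel_measurable borel" "\<And>x. 1 \<le> w x" "integrable unit_lebesgue w"
    and wd: "\<And>k x. x \<in> {0<..<d k} \<Longrightarrow> 1 / (2^k * d k) \<le> w x"
    using exists_singular_weight[OF d] by blast
  interpret weight w using w by unfold_locales
  have f: "f \<in> L2 \<mu>"
    unfolding f_def using norm_modulated_sawtooth_le
    by (intro L2_bounded[where C = 1] measurable_M measurable_modulated_sawtooth) (auto simp: space_M)
  have "\<not> L2_tendsto \<mu> (fourier_sum c) f" for c
  proof
    assume lim: "L2_tendsto \<mu> (fourier_sum c) f"
    have L: "fourier_sum c N \<in> L2 \<mu>" for c N by (intro trig_polys_L2 fourier_sum_trig_poly)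
    \<comment> \<open>Convergence forces the coefficients, so the \<open>T k\<close> are among the
      partial sums and inherit their bound.\<close>
    have "c = fourier_coeff f" using L2_tendsto_imp_fourier_coeff[OF f lim] by auto
    with L2_tendsto_imp_bounded[OF L f lim]
    obtain C where C: "\<And>k. (\<integral>x. (cmod (T k x))\<^sup>2 \<partial>\<mu>) \<le> C" by (auto simp: T_def)
    have "2^k \<le> C" for k
    proof -
      have "d k \<le> 1" using d(2)[of k] by (rule order_trans) simp
      \<comment> \<open>Here \<open>a = 1 / 2^k\<close> and \<open>b = 2^k\<close>: the growth of
        the squared partial sums outweighs the decay of the masses.\<close>
      then have "(1 / 2^k) * (2^k)\<^sup>2 \<le> (\<integral>x. (cmod (T k x))\<^sup>2 \<partial>\<mu>)"
        using wd[of _ k] dT[of _ k] d(1)[of k]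
        by (intro integral_\<mu>_ge[of "d k"]) (auto simp: T_def L)
      then show ?thesis using C[of k] by (simp add: power2_eq_square)
    qed
    moreover obtain n where "C < 2^n" using real_arch_pow[of 2 C] by auto
    ultimately show False by (meson not_less)
  qed
  then have div: "\<exists>f\<in>L2 \<mu>. \<not> (\<exists>c. L2_tendsto \<mu> (\<lambda>M x. \<Sum>n = - int M..int M. c n * expo n x) f)"
    using f by (intro bexI[of _ f]) (simp_all add: fourier_sum_def[abs_def])
  have "absolutely_continuous unit_lebesgue \<mu>"
    unfolding \<mu>_def
    by (rule absolutely_continuousI_density[OF measurable_compose[OF measurable_w_unit measurable_ennreal]])
  moreover have "\<exists>B. L2_bounded_operator \<mu> B \<and> L2_positive_semidefinite \<mu> B \<and>
      L2_orthonormal_basis \<mu> (\<lambda>n. B (expo n))"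
    by (intro exI[of _ B] conjI B_bounded_operator B_positive B_expo_orthonormal_basis)
  ultimately show ?thesis
    using div by (intro exI[of _ \<mu>] conjI sets_M allI expo_L2)
qed

end
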